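(* The set $\mathbf{M}$ is $\Sigma^0_1$-complete, indeed $1$-complete; $\mathbf{M}$ is creative; and $\mathbf{M}$ is computably isomorphic to $K$.
   Context: $(\varphi_e)_{e\in\mathbb{N}}$ is a fixed standard acceptable numbering of the unary partial computable functions (with the s-m-n and universal-machine properties); $\mathbf{M}=\{p\in\mathbb{N}:\varphi_p(0)\!\downarrow=1\}$ and $K=\{e:\varphi_e(e)\!\downarrow\}$. $1$-complete means c.e. and every c.e. set is $1$-reducible to it. Computably isomorphic means there is a computable permutation of $\mathbb{N}$ carrying one set onto the other. *)

theory Defs
  imports Main
begin

text \<open>
  Partial computable functions are the \<open>\<mu>\<close>-recursive ones. Terms carry no arity annotation: on
  arguments of an unsuitable number, evaluation has no rule and the term is undefined there.
  Primitive recursion runs on the first argument, and the step function receives the counter,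
  the previous value and the parameters, in that order.
\<close>

datatype recf =
    Zero
  | Succ
  | Proj nat
  | Comp recf "recf list"
  | PrimRec recf recf
  | Mu recf

inductive computes :: "recf \<Rightarrow> nat list \<Rightarrow> nat \<Rightarrow> bool" where
  zero: "computes Zero xs 0"
| succ: "computes Succ [x] (Suc x)"
| proj: "i < length xs \<Longrightarrow> computes (Proj i) xs (xs ! i)"
| comp: "list_all2 (\<lambda>g y. computes g xs y) gs ys \<Longrightarrow> computes f ys z
    \<Longrightarrow> computes (Comp f gs) xs z"
| prim_rec_0: "computes f xs y \<Longrightarrow> computes (PrimRec f g) (0 # xs) y"
| prim_rec_Suc: "computes (PrimRec f g) (n # xs) y \<Longrightarrow> computes g (n # y # xs) z
    \<Longrightarrow> computes (PrimRec f g) (Suc n # xs) z"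
| mu: "computes f (n # xs) 0 \<Longrightarrow> (\<forall>m<n. \<exists>k. computes f (m # xs) (Suc k))
    \<Longrightarrow> computes (Mu f) xs n"

definition partial_computable :: "(nat \<rightharpoonup> nat) \<Rightarrow> bool" where
  "partial_computable \<psi> \<longleftrightarrow> (\<exists>f. \<forall>x y. \<psi> x = Some y \<longleftrightarrow> computes f [x] y)"

definition partial_computable2 :: "(nat \<Rightarrow> nat \<rightharpoonup> nat) \<Rightarrow> bool" where
  "partial_computable2 \<psi> \<longleftrightarrow> (\<exists>f. \<forall>x y z. \<psi> x y = Some z \<longleftrightarrow> computes f [x, y] z)"

definition computable :: "(nat \<Rightarrow> nat) \<Rightarrow> bool" where
  "computable f \<longleftrightarrow> partial_computable (\<lambda>x. Some (f x))"

definition computable_rel :: "(nat \<Rightarrow> nat \<Rightarrow> bool) \<Rightarrow> bool" where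
  "computable_rel R \<longleftrightarrow> partial_computable2 (\<lambda>x y. Some (if R x y then 1 else 0))"

text \<open>
  The three conjuncts say that \<open>\<phi>\<close> lists exactly the unary partial computable functions, that
  \<open>(e, x) \<mapsto> \<phi> e x\<close> is partial computable (universal machine), and the s-m-n property: an index
  of each section \<open>\<psi> x\<close> of a binary partial computable function is computable from \<open>x\<close>.
\<close>

definition acceptable_numbering :: "(nat \<Rightarrow> nat \<rightharpoonup> nat) \<Rightarrow> bool" where
  "acceptable_numbering \<phi> \<longleftrightarrow>
     range \<phi> = {\<psi>. partial_computable \<psi>} \<and>
     partial_computable2 \<phi> \<and>
     (\<forall>\<psi>. partial_computable2 \<psi> \<longrightarrow> (\<exists>s. computable s \<and> (\<forall>x y. \<phi> (s x) y = \<psi> x y)))"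

definition ce :: "nat set \<Rightarrow> bool" where
  "ce A \<longleftrightarrow> (\<exists>\<psi>. partial_computable \<psi> \<and> A = dom \<psi>)"

definition Sigma01 :: "nat set \<Rightarrow> bool" where
  "Sigma01 A \<longleftrightarrow> (\<exists>R. computable_rel R \<and> A = {x. \<exists>y. R x y})"

definition m_reducible :: "nat set \<Rightarrow> nat set \<Rightarrow> bool" where
  "m_reducible A B \<longleftrightarrow> (\<exists>f. computable f \<and> (\<forall>x. x \<in> A \<longleftrightarrow> f x \<in> B))"

definition one_reducible :: "nat set \<Rightarrow> nat set \<Rightarrow> bool" where
  "one_reducible A B \<longleftrightarrow> (\<exists>f. computable f \<and> inj f \<and> (\<forall>x. x \<in> A \<longleftrightarrow> f x \<in> B))"

definition Sigma01_complete :: "nat set \<Rightarrow> bool" where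
  "Sigma01_complete A \<longleftrightarrow> Sigma01 A \<and> (\<forall>B. Sigma01 B \<longrightarrow> m_reducible B A)"

definition one_complete :: "nat set \<Rightarrow> bool" where
  "one_complete A \<longleftrightarrow> ce A \<and> (\<forall>B. ce B \<longrightarrow> one_reducible B A)"

definition productive :: "(nat \<Rightarrow> nat \<rightharpoonup> nat) \<Rightarrow> nat set \<Rightarrow> bool" where
  "productive \<phi> P \<longleftrightarrow>
     (\<exists>\<psi>. partial_computable \<psi> \<and>
          (\<forall>e. dom (\<phi> e) \<subseteq> P \<longrightarrow> (\<exists>y. \<psi> e = Some y \<and> y \<in> P - dom (\<phi> e))))"

definition creative :: "(nat \<Rightarrow> nat \<rightharpoonup> nat) \<Rightarrow> nat set \<Rightarrow> bool" where
  "creative \<phi> A \<longleftrightarrow> ce A \<and> productive \<phi> (- A)"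

text \<open>The inverse of a computable permutation is itself computable, so it need not be required.\<close>

definition computably_isomorphic :: "nat set \<Rightarrow> nat set \<Rightarrow> bool" where
  "computably_isomorphic A B \<longleftrightarrow> (\<exists>\<pi>. computable \<pi> \<and> bij \<pi> \<and> \<pi> ` A = B)"

definition M_set :: "(nat \<Rightarrow> nat \<rightharpoonup> nat) \<Rightarrow> nat set" where
  "M_set \<phi> = {p. \<phi> p 0 = Some 1}"

definition K_set :: "(nat \<Rightarrow> nat \<rightharpoonup> nat) \<Rightarrow> nat set" where
  "K_set \<phi> = {e. \<phi> e e \<noteq> None}"

end

theory Submission
  imports Defs "HOL-Library.Nat_Bijection"
begin

text \<open>
  By the recursion theorem, for every semidecidable \<open>C\<close> there is a computable \<open>h\<close> with
  \<open>h z \<in> A \<longleftrightarrow> C (h z, z)\<close>, both for \<open>A = M_set \<phi>\<close> and for \<open>A = K_set \<phi>\<close>. Any c.e. set \<open>A\<close> with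
  this property is creative: let \<open>C (u, e)\<close> say that \<open>\<phi> e u\<close> is defined. Moreover, given a c.e. set
  \<open>B\<close>, a number \<open>x\<close> and a finite set \<open>D\<close>, one can compute a number outside \<open>D\<close> that lies in \<open>A\<close>
  exactly if \<open>x \<in> B\<close>. This gives injective reductions, and a back-and-forth construction turns
  it into a computable isomorphism of any two such sets.

  That the graph of a \<open>\<mu>\<close>-recursive function is semidecidable, the part of Kleene's normal form
  theorem that is needed, follows by induction on the term, so programs need not be coded as numbers.
\<close>

subsection \<open>Total recursive functions of fixed arity\<close>

inductive_cases computes_ZeroE: "computes Zero xs y"
inductive_cases computes_SuccE: "computes Succ xs y"
inductive_cases computes_ProjE: "computes (Proj i) xs y"
inductive_cases computes_CompE: "computes (Comp f gs) xs y"
inductive_cases computes_PrimRec_0E: "computes (PrimRec f g) (0 # xs) y"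
inductive_cases computes_PrimRec_SucE: "computes (PrimRec f g) (Suc n # xs) y"
inductive_cases computes_MuE: "computes (Mu f) xs y"

text \<open>Inverting the second evaluation yields the rule used in the first. For minimization two
  results must agree: at the smaller one, a zero of the function, the other run would need a
  positive value.\<close>

lemma computes_deterministic:
  "computes f xs y \<Longrightarrow> computes f xs z \<Longrightarrow> y = z"
proof (induction arbitrary: z rule: computes.induct)
  case (zero xs)
  then show ?case by (blast elim: computes_ZeroE)
next
  case (succ x)
  then show ?case by (blast elim: computes_SuccE)
next
  case (proj i xs)
  then show ?case by (blast elim: computes_ProjE)
next
  case (comp xs gs ys f w)
  from comp.prems obtain ys' where ys': "list_all2 (\<lambda>g y. computes g xs y) gs ys'" "computes f ys' z"
    by (rule computes_CompE)
  have "ys = ys'"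
    using comp.IH(1) ys'(1) by (auto simp: list_all2_conv_all_nth intro!: nth_equalityI)
  then show ?case using comp.IH(2) ys'(2) by blast
next
  case (prim_rec_0 f xs y g)
  then show ?case by (blast elim: computes_PrimRec_0E)
next
  case (prim_rec_Suc f g n xs y z)
  then show ?case by (blast elim: computes_PrimRec_SucE)
next
  case (mu f n xs)
  from mu.prems have z: "computes f (z # xs) 0" "\<forall>m<z. \<exists>k. computes f (m # xs) (Suc k)"
    by (blast elim: computes_MuE)+
  show ?case
  proof (rule linorder_cases[of n z])
    assume "n < z"
    then obtain k where "computes f (n # xs) (Suc k)" using z(2) by blast
    then show ?thesis using mu.IH(1) by blast
  next
    assume "z < n"
    then show ?thesis using mu.IH(2) z(1) by blast
  qed
qed

text \<open>Functions on lists stand for \<open>k\<close>-ary functions, and only lists of length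
  \<open>k\<close> are constrained. Closure under composition and recursion can then be stated once
  for all arities.\<close>

definition recursive :: "nat \<Rightarrow> (nat list \<Rightarrow> nat) \<Rightarrow> bool" where
  "recursive k F \<longleftrightarrow> (\<exists>f. \<forall>xs. length xs = k \<longrightarrow> computes f xs (F xs))"

abbreviation recursive2 :: "(nat \<Rightarrow> nat \<Rightarrow> nat) \<Rightarrow> bool" where
  "recursive2 F \<equiv> recursive 2 (\<lambda>xs. F (xs ! 0) (xs ! 1))"

lemma computableI: "(\<And>x. computes f [x] (F x)) \<Longrightarrow> computable F"
  unfolding computable_def partial_computable_def
  by (metis computes_deterministic option.inject)

lemma computable_iff_recursive: "computable F \<longleftrightarrow> recursive 1 (\<lambda>xs. F (xs ! 0))"
proof
  assume "computable F"
  then obtain f where f: "\<And>x. computes f [x] (F x)"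
    unfolding computable_def partial_computable_def by auto
  show "recursive 1 (\<lambda>xs. F (xs ! 0))"
    unfolding recursive_def by (rule exI[of _ f]) (auto simp: length_Suc_conv f)
next
  assume "recursive 1 (\<lambda>xs. F (xs ! 0))"
  then obtain f where "\<And>xs. length xs = 1 \<Longrightarrow> computes f xs (F (xs ! 0))"
    unfolding recursive_def by blast
  from this[of "[_]"] have "computes f [x] (F x)" for x by simp
  then show "computable F" by (rule computableI)
qed

lemma recursive2_iff: "recursive2 F \<longleftrightarrow> (\<exists>f. \<forall>x y. computes f [x, y] (F x y))"
proof
  assume "recursive2 F"
  then obtain f where "\<And>xs. length xs = 2 \<Longrightarrow> computes f xs (F (xs ! 0) (xs ! 1))"
    unfolding recursive_def by blast
  from this[of "[_, _]"] show "\<exists>f. \<forall>x y. computes f [x, y] (F x y)" by auto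
next
  assume "\<exists>f. \<forall>x y. computes f [x, y] (F x y)"
  then show "recursive2 F"
    unfolding recursive_def by (fastforce simp: length_Suc_conv numeral_2_eq_2)
qed

lemma recursive_nth: "i < k \<Longrightarrow> recursive k (\<lambda>xs. xs ! i)"
  unfolding recursive_def by (auto intro: computes.proj)

lemma recursive_comp:
  assumes F: "computable F" and G: "recursive k G"
  shows "recursive k (\<lambda>xs. F (G xs))"
proof -
  obtain f where f: "\<And>x. computes f [x] (F x)"
    using F unfolding computable_def partial_computable_def by auto
  obtain g where g: "\<And>xs. length xs = k \<Longrightarrow> computes g xs (G xs)"
    using G unfolding recursive_def by blast
  have "computes (Comp f [g]) xs (F (G xs))" if "length xs = k" for xs
    by (rule computes.comp[where ys = "[G xs]"]) (use f g that in auto)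
  then show ?thesis unfolding recursive_def by blast
qed

lemma recursive_comp2:
  assumes F: "recursive2 F" and G: "recursive k G" and H: "recursive k H"
  shows "recursive k (\<lambda>xs. F (G xs) (H xs))"
proof -
  obtain f where f: "\<And>x y. computes f [x, y] (F x y)"
    using F unfolding recursive2_iff by blast
  obtain g where g: "\<And>xs. length xs = k \<Longrightarrow> computes g xs (G xs)"
    using G unfolding recursive_def by blast
  obtain h where h: "\<And>xs. length xs = k \<Longrightarrow> computes h xs (H xs)"
    using H unfolding recursive_def by blast
  have "computes (Comp f [g, h]) xs (F (G xs) (H xs))" if "length xs = k" for xs
    by (rule computes.comp[where ys = "[G xs, H xs]"]) (use f g h that in auto)
  then show ?thesis unfolding recursive_def by blast
qed

lemma computable_Suc: "computable Suc"
  by (rule computableI) (rule computes.succ)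

lemma computable_compose: "computable F \<Longrightarrow> computable G \<Longrightarrow> computable (\<lambda>x. F (G x))"
  unfolding computable_iff_recursive[of G] computable_iff_recursive[of "\<lambda>x. F (G x)"]
  by (rule recursive_comp)

lemma recursive_const: "recursive k (\<lambda>_. c)"
proof (induction c)
  case 0
  then show ?case unfolding recursive_def by (auto intro: computes.zero)
next
  case (Suc c)
  then show ?case by (rule recursive_comp[OF computable_Suc])
qed

lemma recursive_rec_nat:
  assumes B: "recursive k B" and N: "recursive k N" and S: "recursive (Suc (Suc k)) S"
  shows "recursive k (\<lambda>xs. rec_nat (B xs) (\<lambda>n y. S (n # y # xs)) (N xs))"
proof -
  obtain b where b: "\<And>xs. length xs = k \<Longrightarrow> computes b xs (B xs)"
    using B unfolding recursive_def by blast
  obtain n where n: "\<And>xs. length xs = k \<Longrightarrow> computes n xs (N xs)"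
    using N unfolding recursive_def by blast
  obtain s where s: "\<And>xs. length xs = Suc (Suc k) \<Longrightarrow> computes s xs (S xs)"
    using S unfolding recursive_def by blast
  have rec: "computes (PrimRec b s) (m # xs) (rec_nat (B xs) (\<lambda>n y. S (n # y # xs)) m)"
    if "length xs = k" for m xs
  proof (induction m)
    case 0
    then show ?case using b that by (auto intro: computes.prim_rec_0)
  next
    case (Suc m)
    have "computes s (m # rec_nat (B xs) (\<lambda>n y. S (n # y # xs)) m # xs)
        (S (m # rec_nat (B xs) (\<lambda>n y. S (n # y # xs)) m # xs))"
      by (rule s) (use that in simp)
    with Suc show ?case by (auto intro: computes.prim_rec_Suc)
  qed
  \<comment> \<open>The recursion argument is computed by \<open>n\<close> and put in front of the
    parameters, which the projections copy.\<close>
  have "computes (Comp (PrimRec b s) (n # map Proj [0..<k])) xs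
      (rec_nat (B xs) (\<lambda>n y. S (n # y # xs)) (N xs))" if "length xs = k" for xs
  proof (rule computes.comp[where ys = "N xs # xs"])
    have "list_all2 (\<lambda>g y. computes g xs y) (map Proj [0..<k]) xs"
      using that by (auto simp: list_all2_conv_all_nth intro: computes.proj)
    with n that show "list_all2 (\<lambda>g y. computes g xs y) (n # map Proj [0..<k]) (N xs # xs)" by simp
  qed (use rec that in simp)
  then show ?thesis unfolding recursive_def by blast
qed

lemma computable_Least:
  assumes F: "recursive2 F" and ex: "\<And>x. \<exists>n. F n x = 0"
  shows "computable (\<lambda>x. LEAST n. F n x = 0)"
proof -
  obtain f where f: "\<And>x y. computes f [x, y] (F x y)"
    using F unfolding recursive2_iff by blast
  have "computes (Mu f) [x] (LEAST n. F n x = 0)" for x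
  proof (rule computes.mu)
    show "computes f [LEAST n. F n x = 0, x] 0"
      using f[of "LEAST n. F n x = 0" x] LeastI_ex[OF ex[of x]] by simp
    show "\<forall>m<LEAST n. F n x = 0. \<exists>k. computes f [m, x] (Suc k)"
      using f[of _ x] by (metis not_less_Least not0_implies_Suc)
  qed
  then show ?thesis by (rule computableI)
qed

section \<open>Arithmetic and the Cantor pairing\<close>

lemma recursive2_add: "recursive2 (+)"
proof -
  \<comment> \<open>The step is written as a function of the list \<open>n # y # xs\<close>, as in
    \<open>recursive_rec_nat\<close>: entry 0 is the counter, entry 1 the previous value.\<close>
  have "recursive 2 (\<lambda>xs. rec_nat (xs ! 0) (\<lambda>n y. (\<lambda>ys. Suc (ys ! 1)) (n # y # xs)) (xs ! 1))"
    by (intro recursive_rec_nat recursive_nth recursive_comp[OF computable_Suc]) auto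
  moreover have "rec_nat a (\<lambda>n y. Suc y) b = a + b" for a b :: nat by (induction b) auto
  ultimately show ?thesis by simp
qed

text \<open>A recursion whose step returns the counter gives the predecessor; iterating the latter
  gives truncated subtraction.\<close>

lemma computable_pred: "computable (\<lambda>n. n - 1)"
proof -
  have "recursive 1 (\<lambda>xs. rec_nat 0 (\<lambda>n y. (\<lambda>ys. ys ! 0) (n # y # xs)) (xs ! 0))"
    by (intro recursive_rec_nat recursive_nth recursive_const) auto
  moreover have "rec_nat 0 (\<lambda>n y. n) b = b - 1" for b :: nat by (cases b) auto
  ultimately show ?thesis unfolding computable_iff_recursive by simp
qed

lemma recursive2_diff: "recursive2 (-)"
proof -
  have "recursive 2 (\<lambda>xs. rec_nat (xs ! 0) (\<lambda>n y. (\<lambda>ys. ys ! 1 - 1) (n # y # xs)) (xs ! 1))"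
    by (intro recursive_rec_nat recursive_nth recursive_comp[OF computable_pred]) auto
  moreover have "rec_nat a (\<lambda>n y. y - 1) b = a - b" for a b :: nat by (induction b) auto
  ultimately show ?thesis by simp
qed

lemma computable_triangle: "computable triangle"
proof -
  have "recursive 1 (\<lambda>xs. rec_nat 0 (\<lambda>n y. (\<lambda>ys. ys ! 1 + Suc (ys ! 0)) (n # y # xs)) (xs ! 0))"
    by (intro recursive_rec_nat recursive_nth recursive_const recursive_comp2[OF recursive2_add]
        recursive_comp[OF computable_Suc]) auto
  moreover have "rec_nat 0 (\<lambda>n y. y + Suc n) b = triangle b" for b :: nat by (induction b) auto
  ultimately show ?thesis unfolding computable_iff_recursive by simp
qed

lemma recursive2_prod_encode: "recursive2 (\<lambda>x y. prod_encode (x, y))"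
  unfolding prod_encode_def split
  by (intro recursive_nth recursive_comp2[OF recursive2_add] recursive_comp[OF computable_triangle]) auto

text \<open>The diagonal of the Cantor pairing on which a code \<open>p\<close> lies is found by unbounded search; the
  components are then differences.\<close>

lemma prod_decode_search:
  defines "w \<equiv> \<lambda>p. LEAST n. Suc p - triangle (Suc n) = 0"
  shows "prod_decode p = (p - triangle (w p), w p - (p - triangle (w p)))"
proof -
  obtain a b where ab: "prod_decode p = (a, b)" by fastforce
  then have "p = prod_encode (a, b)" using prod_decode_inverse[of p] by simp
  then have p: "p = triangle (a + b) + a" by (simp add: prod_encode_def)
  have mono: "triangle m \<le> triangle n" if "m \<le> n" for m n
    using that by (induction rule: dec_induct) auto
  \<comment> \<open>The truncated difference in \<open>w\<close> vanishes exactly if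
    \<open>p < triangle (Suc n)\<close>, and
    \<open>triangle (a + b) \<le> p < triangle (Suc (a + b))\<close>.\<close>
  have "w p = a + b"
    unfolding w_def
  proof (rule Least_equality)
    show "Suc p - triangle (Suc (a + b)) = 0" using p by simp
  next
    fix n assume n: "Suc p - triangle (Suc n) = 0"
    show "a + b \<le> n"
    proof (rule ccontr)
      assume "\<not> a + b \<le> n"
      then have "triangle (Suc n) \<le> triangle (a + b)" by (intro mono) simp
      with n p show False by simp
    qed
  qed
  with p ab show ?thesis by simp
qed

lemma computable_prod_decode:
  "computable (\<lambda>p. fst (prod_decode p))" "computable (\<lambda>p. snd (prod_decode p))"
proof -
  define w where "w p = (LEAST n. Suc p - triangle (Suc n) = 0)" for p
  have w: "computable w"
    unfolding w_def
  proof (rule computable_Least)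
    show "recursive2 (\<lambda>n p. Suc p - triangle (Suc n))"
      by (intro recursive_nth recursive_comp2[OF recursive2_diff] recursive_comp[OF computable_triangle]
          recursive_comp[OF computable_Suc]) auto
    fix p
    \<comment> \<open>Hence \<open>triangle (Suc p)\<close> exceeds \<open>p\<close>, and the search
      stops at \<open>p\<close> at the latest.\<close>
    have "triangle n \<ge> n" for n by (induction n) auto
    from this[of "Suc p"] show "\<exists>n. Suc p - triangle (Suc n) = 0" by (auto intro: exI[of _ p])
  qed
  show fst: "computable (\<lambda>p. fst (prod_decode p))"
    unfolding prod_decode_search w_def[symmetric] fst_conv computable_iff_recursive
    by (intro recursive_nth recursive_comp2[OF recursive2_diff] recursive_comp[OF computable_triangle]
        recursive_comp[OF w]) auto
  show "computable (\<lambda>p. snd (prod_decode p))"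
    unfolding prod_decode_search w_def[symmetric] snd_conv computable_iff_recursive
    by (intro recursive_nth recursive_comp2[OF recursive2_diff] recursive_comp[OF computable_triangle]
        recursive_comp[OF w]) auto
qed

subsection \<open>Computable maps between coded types\<close>

text \<open>Codes are onto as well as injective, so every number decodes to an object and a map
  becomes a total function on numbers by conjugation. Pairs and lists can thus serve as arguments,
  results and witnesses.\<close>

class coded =
  fixes code :: "'a \<Rightarrow> nat"
  assumes bij_code: "bij code"
begin

definition decode :: "nat \<Rightarrow> 'a" where "decode = inv code"

lemma decode_code [simp]: "decode (code x) = x"
  unfolding decode_def by (simp add: bij_code bij_is_inj)

lemma code_decode [simp]: "code (decode n) = n"
  unfolding decode_def by (simp add: bij_code bij_is_surj surj_f_inv_f)

lemma code_eq_iff [simp]: "code x = code y \<longleftrightarrow> x = y"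
  using bij_code by (simp add: bij_is_inj inj_eq)

end

instantiation nat :: coded
begin
definition code_nat :: "nat \<Rightarrow> nat" where [simp]: "code_nat n = n"
instance
proof
  have "(code :: nat \<Rightarrow> nat) = id" by (simp add: fun_eq_iff)
  then show "bij (code :: nat \<Rightarrow> nat)" by simp
qed
end

instantiation prod :: (coded, coded) coded
begin
definition code_prod :: "'a \<times> 'b \<Rightarrow> nat" where
  "code_prod p = prod_encode (code (fst p), code (snd p))"
instance
proof
  have "code (decode (fst (prod_decode n)) :: 'a, decode (snd (prod_decode n)) :: 'b) = n" for n
    by (simp add: code_prod_def)
  then have "surj (code :: 'a \<times> 'b \<Rightarrow> nat)" by (rule surjI)
  moreover have "inj (code :: 'a \<times> 'b \<Rightarrow> nat)"
    by (rule injI) (auto simp: code_prod_def prod_eq_iff)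
  ultimately show "bij (code :: 'a \<times> 'b \<Rightarrow> nat)" by (simp add: bij_def)
qed
end

instantiation list :: (coded) coded
begin
definition code_list :: "'a list \<Rightarrow> nat" where "code_list xs = list_encode (map code xs)"
instance
proof
  have "code (map decode (list_decode n) :: 'a list) = n" for n
    by (simp add: code_list_def comp_def)
  then have "surj (code :: 'a list \<Rightarrow> nat)" by (rule surjI)
  moreover have "inj (code :: 'a \<Rightarrow> nat)" by (simp add: bij_code bij_is_inj)
  then have "inj (code :: 'a list \<Rightarrow> nat)"
    by (intro injI) (simp add: code_list_def list_encode_eq inj_map_eq_map)
  ultimately show "bij (code :: 'a list \<Rightarrow> nat)" by (simp add: bij_def)
qed
end

lemma code_list_simps [simp]:
  "code [] = 0" "code (x # xs) = Suc (prod_encode (code x, code xs))"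
  by (simp_all add: code_list_def)

definition computable_map :: "('a::coded \<Rightarrow> 'b::coded) \<Rightarrow> bool" where
  "computable_map f \<longleftrightarrow> computable (\<lambda>n. code (f (decode n)))"

definition decidable :: "('a::coded \<Rightarrow> bool) \<Rightarrow> bool" where
  "decidable P \<longleftrightarrow> computable_map (\<lambda>x. if P x then 1 else 0 :: nat)"

lemma decode_nat [simp]: "decode n = (n :: nat)"
  using decode_code[of n] by simp

lemma decode_prod: "decode n = (decode (fst (prod_decode n)), decode (snd (prod_decode n)))"
  using decode_code[of "(decode (fst (prod_decode n)), decode (snd (prod_decode n)))"]
  by (simp add: code_prod_def)

lemma computable_map_nat: "computable_map f \<longleftrightarrow> computable f" for f :: "nat \<Rightarrow> nat"
  by (simp add: computable_map_def)

lemma computable_mapI: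
  assumes "computable F" "\<And>x. code (f x) = F (code x)"
  shows "computable_map f"
  using assms by (simp add: computable_map_def)

lemma computable_id: "computable (\<lambda>n. n)"
  unfolding computable_iff_recursive by (simp add: recursive_nth)

lemma computable_prod_encode:
  "computable F \<Longrightarrow> computable G \<Longrightarrow> computable (\<lambda>n. prod_encode (F n, G n))"
  unfolding computable_iff_recursive by (rule recursive_comp2[OF recursive2_prod_encode])

lemma computable_map_compose:
  "computable_map f \<Longrightarrow> computable_map g \<Longrightarrow> computable_map (\<lambda>x. f (g x))"
  unfolding computable_map_def by (drule (1) computable_compose) simp

lemma decidable_compose: "decidable P \<Longrightarrow> computable_map g \<Longrightarrow> decidable (\<lambda>x. P (g x))"
  unfolding decidable_def by (drule (1) computable_map_compose)

lemma computable_map_const: "computable_map (\<lambda>_. c)"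
  unfolding computable_map_def computable_iff_recursive by (rule recursive_const)

lemma computable_map_ident: "computable_map (\<lambda>x. x)"
  by (simp add: computable_map_def computable_id)

text \<open>On codes this map and the next three are the identity, because numbers code themselves
  and pairs of numbers are coded by \<open>prod_encode\<close>.\<close>

lemma computable_map_code: "computable_map code"
  by (rule computable_mapI[OF computable_id]) simp

lemma computable_map_decode: "computable_map decode"
  by (rule computable_mapI[OF computable_id]) simp

lemma computable_map_prod_decode: "computable_map prod_decode"
  by (rule computable_mapI[OF computable_id]) (simp add: code_prod_def)

lemma computable_map_prod_encode: "computable_map prod_encode"
  by (rule computable_mapI[OF computable_id]) (simp add: code_prod_def)

lemma computable_map_fst: "computable_map fst"
  by (rule computable_mapI[OF computable_prod_decode(1)]) (simp add: code_prod_def)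

lemma computable_map_snd: "computable_map snd"
  by (rule computable_mapI[OF computable_prod_decode(2)]) (simp add: code_prod_def)

lemma computable_map_Pair:
  "computable_map f \<Longrightarrow> computable_map g \<Longrightarrow> computable_map (\<lambda>x. (f x, g x))"
  unfolding computable_map_def code_prod_def by (simp add: computable_prod_encode)

lemma computable_map_Suc: "computable_map Suc"
  by (simp add: computable_map_nat computable_Suc)

lemma computable_map_rec_nat:
  assumes f: "computable_map (f :: 'a::coded \<Rightarrow> 'b::coded)"
    and g: "computable_map (\<lambda>z. g (fst z) (fst (snd z)) (snd (snd z)))"
    and h: "computable_map h"
  shows "computable_map (\<lambda>x. rec_nat (f x) (\<lambda>n y. g n y x) (h x))"
proof -
  \<comment> \<open>\<open>G\<close> is the step function on codes, and \<open>F\<close> the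
    recursion on codes with the single parameter \<open>m\<close>. The list entries 0, 1 and 2 are
    the counter, the code of the previous value and the parameter.\<close>
  define G where "G m = code ((\<lambda>z. g (fst z) (fst (snd z)) (snd (snd z))) (decode m))" for m
  define F where "F m = rec_nat (code (f (decode m)))
    (\<lambda>n y. (\<lambda>xs. G (prod_encode (xs ! 0, prod_encode (xs ! 1, xs ! 2)))) (n # y # [m])) (h (decode m))" for m
  have "recursive 1 (\<lambda>ms. rec_nat (code (f (decode (ms ! 0))))
    (\<lambda>n y. (\<lambda>xs. G (prod_encode (xs ! 0, prod_encode (xs ! 1, xs ! 2)))) (n # y # ms)) (h (decode (ms ! 0))))"
    using assms unfolding computable_map_def computable_iff_recursive G_def[symmetric]
    by (intro recursive_rec_nat recursive_comp[of G] recursive_nth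
        recursive_comp2[OF recursive2_prod_encode])
       (auto simp: computable_iff_recursive)
  then have "computable F" unfolding computable_iff_recursive F_def by simp
  then show ?thesis
  proof (rule computable_mapI)
    fix x
    have "code (rec_nat (f x) (\<lambda>n y. g n y x) k) =
      rec_nat (code (f x)) (\<lambda>n y. G (prod_encode (n, prod_encode (y, code x)))) k" for k
    proof (induction k)
      case (Suc k)
      have "G (prod_encode (k, prod_encode (code y, code x))) = code (g k y x)" for y :: 'b
        by (simp add: G_def decode_prod)
      then show ?case by (simp flip: Suc)
    qed simp
    then show "code (rec_nat (f x) (\<lambda>n y. g n y x) (h x)) = F (code x)"
      by (simp add: F_def numeral_2_eq_2)
  qed
qed

text \<open>A case distinction is a recursion whose number of rounds, 1 or 0, is the characteristic
  value of \<open>P\<close>.\<close>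

lemma computable_map_If:
  fixes f g :: "'a::coded \<Rightarrow> 'b::coded"
  assumes "decidable P" "computable_map f" "computable_map g"
  shows "computable_map (\<lambda>x. if P x then f x else g x)"
proof -
  have "computable_map (\<lambda>z :: nat \<times> 'b \<times> 'a. f (snd (snd z)))"
    by (intro computable_map_compose[OF assms(2)] computable_map_compose[OF computable_map_snd]
        computable_map_snd)
  with assms have "computable_map (\<lambda>x. rec_nat (g x) (\<lambda>n y. f x) (if P x then 1 else 0))"
    unfolding decidable_def by (intro computable_map_rec_nat)
  moreover have "rec_nat (g x) (\<lambda>n y. f x) (if P x then 1 else 0) = (if P x then f x else g x)" for x
    by simp
  ultimately show ?thesis by simp
qed

lemma decidable_const: "decidable (\<lambda>_. c)"
  unfolding decidable_def by (rule computable_map_const)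

lemma decidable_If:
  assumes "decidable P" "decidable Q" "decidable R"
  shows "decidable (\<lambda>x. if P x then Q x else R x)"
proof -
  have "computable_map (\<lambda>x. if P x then if Q x then 1 else 0 else if R x then 1 else 0 :: nat)"
    by (rule computable_map_If) (use assms in \<open>simp_all only: decidable_def\<close>)
  moreover have "(if P x then if Q x then 1 else 0 else if R x then 1 else 0 :: nat) =
      (if if P x then Q x else R x then 1 else 0)" for x
    by simp
  ultimately show ?thesis by (simp only: decidable_def)
qed

lemma decidable_not: "decidable P \<Longrightarrow> decidable (\<lambda>x. \<not> P x)"
  using decidable_If[of P "\<lambda>_. False" "\<lambda>_. True"] by (simp add: decidable_const if_bool_eq_disj)

lemma decidable_conj: "decidable P \<Longrightarrow> decidable Q \<Longrightarrow> decidable (\<lambda>x. P x \<and> Q x)"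
  using decidable_If[of P Q "\<lambda>_. False"] by (simp add: decidable_const if_bool_eq_disj)

lemma decidable_disj: "decidable P \<Longrightarrow> decidable Q \<Longrightarrow> decidable (\<lambda>x. P x \<or> Q x)"
  using decidable_not[OF decidable_conj[OF decidable_not decidable_not], of P Q] by simp

lemma decidable_eq_nat:
  assumes "computable_map f" "computable_map g"
  shows "decidable (\<lambda>x. f x = (g x :: nat))"
proof -
  \<comment> \<open>The two truncated differences add up to the distance of the values; subtracting
    it from 1 gives the characteristic function of equality.\<close>
  let ?h = "\<lambda>n. 1 - ((code (f (decode n)) - code (g (decode n))) + (code (g (decode n)) - code (f (decode n))))"
  have "computable ?h"
    using assms unfolding computable_map_def computable_iff_recursive
    by (intro recursive_comp2[OF recursive2_diff] recursive_comp2[OF recursive2_add] recursive_const)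
  then show ?thesis
    unfolding decidable_def by (rule computable_mapI) auto
qed

lemma decidable_eq:
  assumes "computable_map f" "computable_map (g :: _ \<Rightarrow> 'b::coded)"
  shows "decidable (\<lambda>x. f x = g x)"
  using decidable_eq_nat[OF assms[THEN computable_map_compose[OF computable_map_code]]] by simp

lemma computable_map_Least:
  fixes P :: "'a::coded \<Rightarrow> nat \<Rightarrow> bool"
  assumes P: "decidable (\<lambda>z. P (fst z) (snd z))" and ex: "\<And>x. \<exists>n. P x n"
  shows "computable_map (\<lambda>x. LEAST n. P x n)"
proof -
  \<comment> \<open>\<open>computable_Least\<close> searches for zeros, so the characteristic
    function \<open>Q\<close> enters as \<open>1 - Q\<close>.\<close>
  define Q where "Q m = (if (\<lambda>z. P (fst z) (snd z)) (decode m) then 1 else 0 :: nat)" for m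
  have Q: "computable Q"
    using P unfolding Q_def decidable_def computable_map_def by simp
  have eq: "1 - Q (prod_encode (m, n)) = 0 \<longleftrightarrow> P (decode m) n" for m n
    by (simp add: Q_def decode_prod)
  have "computable (\<lambda>m. LEAST n. 1 - Q (prod_encode (m, n)) = 0)"
    unfolding eq using ex
    by (intro computable_Least[of "\<lambda>n m. 1 - Q (prod_encode (m, n))", unfolded eq]
       recursive_comp2[OF recursive2_diff] recursive_const recursive_comp[OF Q]
       recursive_comp2[OF recursive2_prod_encode] recursive_nth) auto
  then show ?thesis
    unfolding eq computable_map_def by simp
qed

named_theorems computable_intros

text \<open>Projections and coding maps appear composed with an arbitrary computable argument, so
  that the rules apply backwards to compound expressions.\<close>

lemmas [computable_intros] =
  computable_map_const computable_map_ident computable_map_Pair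
  computable_map_compose[OF computable_map_fst]
  computable_map_compose[OF computable_map_snd]
  computable_map_compose[OF computable_map_Suc]
  computable_map_compose[OF computable_map_prod_decode]
  computable_map_compose[OF computable_map_prod_encode]
  computable_map_compose[OF computable_map_code]
  computable_map_compose[OF computable_map_decode]
  computable_map_If decidable_const decidable_not decidable_conj decidable_disj decidable_eq

text \<open>The search for the bound or a counterexample always stops, and it stops at the bound
  exactly if there is no counterexample below it.\<close>

lemma decidable_all_less [computable_intros]:
  fixes h :: "'a::coded \<Rightarrow> nat"
  assumes P: "decidable (\<lambda>z. P (fst z) (snd z))" and h: "computable_map h"
  shows "decidable (\<lambda>x. \<forall>i<h x. P x i)"
proof -
  let ?l = "\<lambda>x. LEAST n. n = h x \<or> \<not> P x n"
  have "computable_map ?l"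
    using P by (intro computable_map_Least computable_intros computable_map_compose[OF h]) auto
  moreover have "(\<forall>i<h x. P x i) \<longleftrightarrow> ?l x = h x" for x
  proof
    assume *: "\<forall>i<h x. P x i"
    have "h x \<le> m" if "m = h x \<or> \<not> P x m" for m using * that not_le_imp_less by blast
    then show "?l x = h x" by (intro Least_equality) auto
  next
    assume "?l x = h x"
    then show "\<forall>i<h x. P x i" using not_less_Least[of _ "\<lambda>n. n = h x \<or> \<not> P x n"] by auto
  qed
  ultimately show ?thesis using h by (auto intro!: decidable_eq)
qed

lemma decidable_ex_less [computable_intros]:
  fixes h :: "'a::coded \<Rightarrow> nat"
  assumes P: "decidable (\<lambda>z. P (fst z) (snd z))" and h: "computable_map h"
  shows "decidable (\<lambda>x. \<exists>i<h x. P x i)"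
proof -
  from decidable_not[OF decidable_all_less[OF decidable_not[OF P] h]] show ?thesis by simp
qed

lemma decidable_less [computable_intros]:
  assumes "computable_map f" "computable_map g"
  shows "decidable (\<lambda>x. f x < (g x :: nat))"
proof -
  have "decidable (\<lambda>x. \<exists>i<g x. f x = i)"
    by (intro computable_intros assms computable_map_compose[OF assms(1)])
  then show ?thesis by simp
qed

section \<open>Computable operations on lists\<close>

lemma computable_map_Cons [computable_intros]:
  assumes "computable_map f" "computable_map g"
  shows "computable_map (\<lambda>x. f x # g x)"
  using assms unfolding computable_map_def code_list_simps
  by (intro computable_compose[OF computable_Suc] computable_prod_encode)

lemma computable_map_tl: "computable_map tl"
proof (rule computable_mapI)
  show "computable (\<lambda>n. snd (prod_decode (n - 1)))"
    by (intro computable_compose[OF computable_prod_decode(2)] computable_pred)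
  \<comment> \<open>For the empty list the truncated predecessor of the code 0 is again 0, whose
    second component 0 is the code of \<open>tl []\<close>.\<close>
  have "prod_decode 0 = (0, 0)"
    using prod_encode_inverse[of "(0, 0)"] by (simp add: prod_encode_def)
  then show "code (tl xs) = snd (prod_decode (code xs - 1))" for xs :: "'a list"
    by (cases xs) auto
qed

lemma computable_map_hd: "computable_map (hd :: 'a::coded list \<Rightarrow> 'a)"
proof -
  \<comment> \<open>The value \<open>hd []\<close> is unspecified but fixed, hence a computable
    constant.\<close>
  have "computable_map (\<lambda>xs :: 'a list. if xs = [] then hd [] :: 'a else decode (fst (prod_decode (code xs - 1))))"
    by (intro computable_intros computable_map_compose[OF computable_pred[folded computable_map_nat]])
  moreover have "(\<lambda>xs :: 'a list. if xs = [] then hd [] :: 'a else decode (fst (prod_decode (code xs - 1)))) = hd"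
    by (auto simp: fun_eq_iff neq_Nil_conv)
  ultimately show ?thesis by (simp only:)
qed

lemmas [computable_intros] =
  computable_map_compose[OF computable_map_tl]
  computable_map_compose[OF computable_map_hd]

lemma computable_map_drop [computable_intros]:
  assumes "computable_map h" "computable_map g"
  shows "computable_map (\<lambda>x. drop (h x) (g x))"
proof -
  have "computable_map (\<lambda>x. rec_nat (g x) (\<lambda>_ ys. tl ys) (h x))"
    by (intro computable_map_rec_nat computable_intros assms)
  moreover have "rec_nat ys (\<lambda>_ ys. tl ys) n = drop n ys" for n and ys :: "'b list"
    by (induction n) (simp_all add: drop_Suc tl_drop)
  ultimately show ?thesis by simp
qed

lemma computable_map_length: "computable_map length"
proof -
  have "computable_map (\<lambda>xs. LEAST n. drop n xs = ([] :: 'a list))"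
    by (intro computable_map_Least computable_intros) auto
  moreover have "(LEAST n. drop n xs = []) = length xs" for xs :: "'a list"
    by (rule Least_equality) auto
  ultimately show ?thesis by simp
qed

lemmas [computable_intros] = computable_map_compose[OF computable_map_length]

lemma computable_map_fold:
  fixes g :: "'b::coded \<Rightarrow> 'c::coded \<Rightarrow> 'a::coded \<Rightarrow> 'c"
  assumes g: "computable_map (\<lambda>z. g (fst z) (fst (snd z)) (snd (snd z)))"
    and l: "computable_map l" and a: "computable_map a"
  shows "computable_map (\<lambda>x. fold (\<lambda>y s. g y s x) (l x) (a x))"
proof -
  have *: "computable_map (\<lambda>x. rec_nat (a x) (\<lambda>n s. g (hd (drop n (l x))) s x) (length (l x)))"
  proof (intro computable_map_rec_nat a computable_intros l)
    show "computable_map (\<lambda>z. g (hd (drop (fst z) (l (snd (snd z))))) (fst (snd z)) (snd (snd z)))"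
      using computable_map_compose[OF g, of "\<lambda>z. (hd (drop (fst z) (l (snd (snd z)))), snd z)"]
      by (simp add: computable_intros computable_map_compose[OF l])
  qed
  have "rec_nat s (\<lambda>n s. h (hd (drop n ys)) s) (length ys) = fold h ys s"
    for h :: "'b \<Rightarrow> 'c \<Rightarrow> 'c" and ys s
  proof -
    \<comment> \<open>Invariant: after \<open>n\<close> rounds the first \<open>n\<close> entries
      have been folded in.\<close>
    have "n \<le> length ys \<Longrightarrow> rec_nat s (\<lambda>n s. h (hd (drop n ys)) s) n = fold h (take n ys) s" for n
      by (induction n) (auto simp: take_Suc_conv_app_nth hd_drop_conv_nth)
    then show ?thesis by simp
  qed
  note this[of "a x" "\<lambda>y s. g y s x" "l x" for x]
  with * show ?thesis by simp
qed

text \<open>Folding with \<open>#\<close> produces the image list in reverse order. This is harmless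
  for \<open>left\<close> and \<open>right\<close> in the back-and-forth construction, where only
  the set of entries counts.\<close>

lemma computable_map_rev_map [computable_intros]:
  assumes g: "computable_map g" and l: "computable_map l"
  shows "computable_map (\<lambda>x. rev (map g (l x)))"
proof -
  have "computable_map (\<lambda>x. fold (\<lambda>y s. g y # s) (l x) [])"
    by (intro computable_map_fold computable_intros l computable_map_compose[OF g])
  moreover have "fold (\<lambda>y s. g y # s) ys zs = rev (map g ys) @ zs" for ys zs
    by (induction ys arbitrary: zs) auto
  ultimately show ?thesis by simp
qed

lemma decidable_in_set [computable_intros]:
  assumes f: "computable_map f" and l: "computable_map l"
  shows "decidable (\<lambda>x. f x \<in> set (l x))"
proof -
  have "decidable (\<lambda>x. \<exists>i<length (l x). hd (drop i (l x)) = f x)"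
    by (intro computable_intros computable_map_compose[OF f] computable_map_compose[OF l] l)
  moreover have "(\<exists>i<length ys. hd (drop i ys) = y) \<longleftrightarrow> y \<in> set ys" for ys and y :: 'b
    by (auto simp: in_set_conv_nth hd_drop_conv_nth)
  ultimately show ?thesis by simp
qed

subsection \<open>Semidecidable predicates\<close>

definition semidecidable :: "('a::coded \<Rightarrow> bool) \<Rightarrow> bool" where
  "semidecidable S \<longleftrightarrow>
    (\<exists>R. decidable (\<lambda>z. R (fst z) (snd z :: nat)) \<and> (\<forall>x. S x \<longleftrightarrow> (\<exists>t. R x t)))"

lemma semidecidableE:
  assumes "semidecidable S"
  obtains R where "decidable (\<lambda>z. R (fst z) (snd z :: nat))" "\<And>x. S x \<longleftrightarrow> (\<exists>t. R x t)"
  using assms unfolding semidecidable_def by blast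

lemma decidable_compose2:
  assumes "decidable (\<lambda>z. R (fst z) (snd z))" "computable_map a" "computable_map b"
  shows "decidable (\<lambda>x. R (a x) (b x))"
  using decidable_compose[OF assms(1) computable_map_Pair[OF assms(2,3)]] by simp

text \<open>Codes are onto, so a quantifier over objects of a coded type is one over numbers.
  Several witnesses can therefore be packed into a pair.\<close>

lemma semidecidableI:
  fixes R :: "'a::coded \<Rightarrow> 'b::coded \<Rightarrow> bool"
  assumes R: "decidable (\<lambda>z. R (fst z) (snd z))" and S: "\<And>x. S x \<longleftrightarrow> (\<exists>t. R x t)"
  shows "semidecidable S"
  unfolding semidecidable_def
proof (intro exI conjI allI)
  show "decidable (\<lambda>z. R (fst z) (decode (snd z)))"
    by (intro decidable_compose2[OF R] computable_intros)
  show "S x \<longleftrightarrow> (\<exists>t. R x (decode t))" for x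
    unfolding S by (metis decode_code)
qed

lemma decidable_imp_semidecidable: "decidable P \<Longrightarrow> semidecidable P"
  by (rule semidecidableI[of "\<lambda>x (t :: nat). P x"]) (simp_all add: decidable_compose[OF _ computable_map_fst])

lemma semidecidable_compose:
  assumes S: "semidecidable S" and g: "computable_map g"
  shows "semidecidable (\<lambda>x. S (g x))"
proof -
  obtain R where R: "decidable (\<lambda>z. R (fst z) (snd z :: nat))" "\<And>x. S x \<longleftrightarrow> (\<exists>t. R x t)"
    using S by (rule semidecidableE) blast
  show ?thesis
    by (rule semidecidableI[of "\<lambda>x. R (g x)"])
       (intro decidable_compose2[OF R(1)] computable_intros computable_map_compose[OF g], rule R(2))
qed

lemma semidecidable_compose2:
  assumes "semidecidable (\<lambda>z. S (fst z) (snd z))" "computable_map a" "computable_map b"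
  shows "semidecidable (\<lambda>x. S (a x) (b x))"
  using semidecidable_compose[OF assms(1) computable_map_Pair[OF assms(2,3)]] by simp

named_theorems semidecidable_intros

lemma semidecidable_ex [semidecidable_intros]:
  fixes S :: "'a::coded \<Rightarrow> 'b::coded \<Rightarrow> bool"
  assumes S: "semidecidable (\<lambda>z. S (fst z) (snd z))"
  shows "semidecidable (\<lambda>x. \<exists>y. S x y)"
proof -
  obtain R where R: "decidable (\<lambda>z. R (fst z) (snd z :: nat))" "\<And>z. S (fst z) (snd z) \<longleftrightarrow> (\<exists>t. R z t)"
    using S by (rule semidecidableE) blast
  show ?thesis
  proof (rule semidecidableI)
    show "decidable (\<lambda>z. R (fst z, fst (snd z)) (snd (snd z)))"
      by (intro decidable_compose2[OF R(1)] computable_intros)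
    show "(\<exists>y. S x y) \<longleftrightarrow> (\<exists>t. R (x, fst t) (snd t))" for x
      using R(2)[of "(x, _)"] by auto
  qed
qed

lemma semidecidable_conj [semidecidable_intros]:
  assumes "semidecidable S" "semidecidable S'"
  shows "semidecidable (\<lambda>x. S x \<and> S' x)"
proof -
  obtain R where R: "decidable (\<lambda>z. R (fst z) (snd z :: nat))" "\<And>x. S x \<longleftrightarrow> (\<exists>t. R x t)"
    using assms(1) by (rule semidecidableE) blast
  obtain R' where R': "decidable (\<lambda>z. R' (fst z) (snd z :: nat))" "\<And>x. S' x \<longleftrightarrow> (\<exists>t. R' x t)"
    using assms(2) by (rule semidecidableE) blast
  show ?thesis
  proof (rule semidecidableI)
    show "decidable (\<lambda>z. R (fst z) (fst (snd z)) \<and> R' (fst z) (snd (snd z)))"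
      by (intro decidable_conj decidable_compose2[OF R(1)] decidable_compose2[OF R'(1)] computable_intros)
    show "S x \<and> S' x \<longleftrightarrow> (\<exists>t. R x (fst t) \<and> R' x (snd t))" for x
      using R(2) R'(2) by auto
  qed
qed

lemma semidecidable_disj [semidecidable_intros]:
  assumes "semidecidable S" "semidecidable S'"
  shows "semidecidable (\<lambda>x. S x \<or> S' x)"
proof -
  obtain R where R: "decidable (\<lambda>z. R (fst z) (snd z :: nat))" "\<And>x. S x \<longleftrightarrow> (\<exists>t. R x t)"
    using assms(1) by (rule semidecidableE) blast
  obtain R' where R': "decidable (\<lambda>z. R' (fst z) (snd z :: nat))" "\<And>x. S' x \<longleftrightarrow> (\<exists>t. R' x t)"
    using assms(2) by (rule semidecidableE) blast
  show ?thesis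
  proof (rule semidecidableI)
    show "decidable (\<lambda>z. R (fst z) (snd z) \<or> R' (fst z) (snd z))"
      by (intro decidable_disj R R')
    show "S x \<or> S' x \<longleftrightarrow> (\<exists>t. R x t \<or> R' x t)" for x
      using R(2) R'(2) by auto
  qed
qed

text \<open>Finitely many witnesses have a common bound \<open>T\<close>, so a single unbounded
  quantifier can be moved to the front. Evaluation of primitive recursion and of minimization is
  treated this way.\<close>

lemma semidecidable_all_less [semidecidable_intros]:
  fixes h :: "'a::coded \<Rightarrow> nat"
  assumes S: "semidecidable (\<lambda>z. S (fst z) (snd z))" and h: "computable_map h"
  shows "semidecidable (\<lambda>x. \<forall>i<h x. S x i)"
proof -
  obtain R where R: "decidable (\<lambda>z. R (fst z) (snd z :: nat))" "\<And>z. S (fst z) (snd z) \<longleftrightarrow> (\<exists>t. R z t)"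
    using S by (rule semidecidableE) blast
  show ?thesis
  proof (rule semidecidableI)
    show "decidable (\<lambda>z. \<forall>i<h (fst z). \<exists>t<snd z. R (fst z, i) t)"
      by (intro computable_intros decidable_compose2[OF R(1)] computable_map_compose[OF h])
    show "(\<forall>i<h x. S x i) \<longleftrightarrow> (\<exists>T. \<forall>i<h x. \<exists>t<T. R (x, i) t)" for x
    proof
      assume "\<forall>i<h x. S x i"
      then have "\<forall>i<h x. \<exists>t. R (x, i) t" using R(2)[of "(x, _)"] by simp
      then obtain t where t: "\<forall>i<h x. R (x, i) (t i)" by metis
      have "t i < Suc (\<Sum>i<h x. t i)" if "i < h x" for i
        using that by (simp add: less_Suc_eq_le member_le_sum)
      with t show "\<exists>T. \<forall>i<h x. \<exists>t<T. R (x, i) t" by blast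
    next
      assume "\<exists>T. \<forall>i<h x. \<exists>t<T. R (x, i) t"
      then show "\<forall>i<h x. S x i" using R(2)[of "(x, _)"] by auto
    qed
  qed
qed

text \<open>A list \<open>l\<close> of intermediate values is read by \<open>hd (drop i l)\<close>, as \<open>l ! i\<close> is unspecified beyond
  the length of \<open>l\<close> and thus not known to be computable there.\<close>

lemma computes_PrimRec_iff:
  "computes (PrimRec f g) xs y \<longleftrightarrow>
    xs \<noteq> [] \<and> (\<exists>l. computes f (tl xs) (hd l) \<and>
      (\<forall>i<hd xs. computes g (i # hd (drop i l) # tl xs) (hd (drop (Suc i) l))) \<and> y = hd (drop (hd xs) l))"
  (is "_ \<longleftrightarrow> _ \<and> (\<exists>l. ?P xs l y)")
proof
  assume y: "computes (PrimRec f g) xs y"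
  then obtain n zs where xs: "xs = n # zs" by (cases rule: computes.cases) auto
  \<comment> \<open>\<open>v\<close> is the trace of the recursion: \<open>v i\<close> is the value
    at counter \<open>i\<close>.\<close>
  have "\<exists>v. computes f zs (v 0) \<and> (\<forall>i<n. computes g (i # v i # zs) (v (Suc i))) \<and> y = v n"
    using y unfolding xs
  proof (induction n arbitrary: y)
    case 0
    then show ?case by (auto elim!: computes_PrimRec_0E intro: exI[of _ "\<lambda>_. y"])
  next
    case (Suc n)
    then obtain y' where y': "computes (PrimRec f g) (n # zs) y'" "computes g (n # y' # zs) y"
      by (blast elim: computes_PrimRec_SucE)
    with Suc.IH obtain v where v: "computes f zs (v 0)" "\<forall>i<n. computes g (i # v i # zs) (v (Suc i))" "y' = v n"
      by blast
    show ?case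
      by (rule exI[of _ "v(Suc n := y)"]) (use v y' in \<open>auto simp: less_Suc_eq\<close>)
  qed
  then obtain v where v: "computes f zs (v 0)" "\<forall>i<n. computes g (i # v i # zs) (v (Suc i))" "y = v n" by blast
  \<comment> \<open>Only positions up to \<open>n\<close> are read, so a list of
    \<open>Suc n\<close> values holds the whole trace.\<close>
  have drop: "hd (drop i (map v [0..<Suc n])) = v i" if "i \<le> n" for i
    using that by (subst hd_drop_conv_nth) (auto simp del: upt_Suc)
  have "?P xs (map v [0..<Suc n]) y"
    using v drop[of 0] drop unfolding xs by (simp del: upt_Suc)
  then show "xs \<noteq> [] \<and> (\<exists>l. ?P xs l y)" using xs by blast
next
  assume "xs \<noteq> [] \<and> (\<exists>l. ?P xs l y)"
  then obtain n zs l where xs: "xs = n # zs" and l: "computes f zs (hd l)"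
      "\<forall>i<n. computes g (i # hd (drop i l) # zs) (hd (drop (Suc i) l))" "y = hd (drop n l)"
    by (auto simp: neq_Nil_conv)
  have "k \<le> n \<Longrightarrow> computes (PrimRec f g) (k # zs) (hd (drop k l))" for k
    by (induction k) (use l in \<open>auto intro: computes.intros\<close>)
  then show "computes (PrimRec f g) xs y" unfolding xs l(3) by simp
qed

section \<open>Evaluation of each kind of term\<close>

lemma semidecidable_Zero: "semidecidable (\<lambda>z. computes Zero (fst z) (snd z))"
proof -
  have "computes Zero xs y \<longleftrightarrow> y = 0" for xs y
    by (blast elim: computes_ZeroE intro: computes.zero)
  then show ?thesis
    by (simp only:) (intro decidable_imp_semidecidable computable_intros)
qed

lemma semidecidable_Succ: "semidecidable (\<lambda>z. computes Succ (fst z) (snd z))"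
proof -
  have "computes Succ xs y \<longleftrightarrow> length xs = 1 \<and> y = Suc (hd xs)" for xs y
    by (auto simp: length_Suc_conv elim: computes_SuccE intro: computes.succ)
  then show ?thesis
    by (simp only:) (intro decidable_imp_semidecidable computable_intros)
qed

lemma semidecidable_Proj: "semidecidable (\<lambda>z. computes (Proj i) (fst z) (snd z))"
proof -
  have "computes (Proj i) xs y \<longleftrightarrow> i < length xs \<and> y = hd (drop i xs)" for xs y
    by (auto simp: hd_drop_conv_nth elim: computes_ProjE intro: computes.proj)
  then show ?thesis
    by (simp only:) (intro decidable_imp_semidecidable computable_intros)
qed

text \<open>The list of intermediate values is a single existential witness. That it consists of the
  values of \<open>gs\<close> is a finite conjunction, treated by induction on
  \<open>gs\<close>.\<close>

lemma semidecidable_Comp: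
  assumes f: "semidecidable (\<lambda>z. computes f (fst z) (snd z))"
    and "\<And>g. g \<in> set gs \<Longrightarrow> semidecidable (\<lambda>z. computes g (fst z) (snd z))"
  shows "semidecidable (\<lambda>z. computes (Comp f gs) (fst z) (snd z))"
proof -
  have gs: "semidecidable (\<lambda>z. list_all2 (\<lambda>g. computes g (fst z)) gs (snd z))"
    using assms(2)
  proof (induction gs)
    case Nil
    have "semidecidable (\<lambda>z :: nat list \<times> nat list. snd z = [])"
      by (intro decidable_imp_semidecidable computable_intros)
    then show ?case by simp
  next
    case (Cons g gs)
    have "list_all2 (\<lambda>g. computes g xs) (g # gs) ys \<longleftrightarrow>
        ys \<noteq> [] \<and> computes g xs (hd ys) \<and> list_all2 (\<lambda>g. computes g xs) gs (tl ys)" for xs ys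
      by (cases ys) auto
    moreover have g: "semidecidable (\<lambda>z. computes g (fst z) (snd z))" using Cons.prems by simp
    moreover have gs: "semidecidable (\<lambda>z. list_all2 (\<lambda>g. computes g (fst z)) gs (snd z))"
      using Cons by simp
    ultimately show ?case
      by (simp only:) (intro semidecidable_intros decidable_imp_semidecidable[OF decidable_not]
          semidecidable_compose2[OF g] semidecidable_compose2[OF gs] computable_intros)
  qed
  have "computes (Comp f gs) xs y \<longleftrightarrow> (\<exists>ys. list_all2 (\<lambda>g. computes g xs) gs ys \<and> computes f ys y)" for xs y
    by (blast elim: computes_CompE intro: computes.comp)
  then show ?thesis
    by (simp only:) (intro semidecidable_intros semidecidable_compose2[OF f]
        semidecidable_compose2[OF gs] computable_intros)
qed

lemma semidecidable_PrimRec: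
  assumes "semidecidable (\<lambda>z. computes f (fst z) (snd z))"
    and "semidecidable (\<lambda>z. computes g (fst z) (snd z))"
  shows "semidecidable (\<lambda>z. computes (PrimRec f g) (fst z) (snd z))"
  unfolding computes_PrimRec_iff
  by (intro semidecidable_intros decidable_imp_semidecidable[OF decidable_not]
      decidable_imp_semidecidable[OF decidable_eq]
      semidecidable_compose2[OF assms(1)] semidecidable_compose2[OF assms(2)] computable_intros)

lemma semidecidable_Mu:
  assumes f: "semidecidable (\<lambda>z. computes f (fst z) (snd z))"
  shows "semidecidable (\<lambda>z. computes (Mu f) (fst z) (snd z))"
proof -
  have "computes (Mu f) xs n \<longleftrightarrow> computes f (n # xs) 0 \<and> (\<forall>m<n. \<exists>k. computes f (m # xs) (Suc k))" for xs n
    by (blast elim: computes_MuE intro: computes.mu)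
  then show ?thesis
    by (simp only:) (intro semidecidable_intros semidecidable_compose2[OF f] computable_intros)
qed

text \<open>The term is fixed, not an argument of the predicate. Uniformity in the program comes
  from the universal machine, to which this is applied in
  \<open>semidecidable_numbering\<close>.\<close>

lemma semidecidable_computes: "semidecidable (\<lambda>z. computes f (fst z) (snd z))"
  by (induction f)
    (blast intro: semidecidable_Zero semidecidable_Succ semidecidable_Proj semidecidable_Comp
      semidecidable_PrimRec semidecidable_Mu)+

lemma semidecidable_partial_computable2:
  assumes "partial_computable2 \<psi>"
  shows "semidecidable (\<lambda>z. \<psi> (fst z) (fst (snd z)) = Some (snd (snd z)))"
proof -
  obtain f where "\<And>x y z. \<psi> x y = Some z \<longleftrightarrow> computes f [x, y] z"
    using assms unfolding partial_computable2_def by blast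
  then show ?thesis
    by (simp only:) (intro semidecidable_compose2[OF semidecidable_computes] computable_intros)
qed

text \<open>The program searches for a witness by minimization and then replaces it by 1, the value
  that membership in \<open>M_set \<phi>\<close> asks for.\<close>

lemma semidecidable_imp_computes:
  fixes S :: "nat \<Rightarrow> bool"
  assumes S: "semidecidable S"
  obtains f where "\<And>x y. computes f [x] y \<longleftrightarrow> S x \<and> y = 1"
proof -
  obtain R where R: "decidable (\<lambda>z. R (fst z) (snd z :: nat))" "\<And>x. S x \<longleftrightarrow> (\<exists>t. R x t)"
    using S by (rule semidecidableE) blast
  \<comment> \<open>Zero marks a witness because minimization looks for zeros; the value 1 elsewhere
    lets the search pass on.\<close>
  define Q where "Q n = (if R (fst (prod_decode n)) (snd (prod_decode n)) then 0 else 1 :: nat)" for n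
  have "computable_map Q"
    unfolding Q_def by (intro computable_intros decidable_compose2[OF R(1)])
  then have Q: "computable Q" by (simp add: computable_map_nat)
  have "recursive2 (\<lambda>t x. Q (prod_encode (x, t)))"
    by (intro recursive_comp[OF Q] recursive_comp2[OF recursive2_prod_encode] recursive_nth) auto
  then obtain g where "\<And>t x. computes g [t, x] (Q (prod_encode (x, t)))"
    unfolding recursive2_iff[of "\<lambda>t x. Q (prod_encode (x, t))"] by blast
  then have g: "computes g [t, x] (if R x t then 0 else 1)" for t x
    by (simp only: Q_def prod_encode_inverse fst_conv snd_conv)
  have g_iff: "computes g [t, x] y \<longleftrightarrow> y = (if R x t then 0 else 1)" for t x y
    using g computes_deterministic by blast
  obtain c where c: "\<And>x. computes c [x] 1"
    using recursive_const[of 1 1] unfolding recursive_def by force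
  have "computes (Comp c [Mu g]) [x] y \<longleftrightarrow> S x \<and> y = 1" for x y
  proof
    assume "computes (Comp c [Mu g]) [x] y"
    then obtain n where n: "computes (Mu g) [x] n" "computes c [n] y"
      by (auto elim!: computes_CompE simp: list_all2_Cons1)
    then have "y = 1" using c computes_deterministic by blast
    moreover have "computes g [n, x] 0" using n(1) by (blast elim: computes_MuE)
    then have "R x n" unfolding g_iff by (auto split: if_splits)
    ultimately show "S x \<and> y = 1" using R(2) by blast
  next
    assume *: "S x \<and> y = 1"
    define n where "n = (LEAST n. R x n)"
    have "R x n" unfolding n_def using * R(2) by (blast intro: LeastI_ex)
    moreover have "\<not> R x m" if "m < n" for m using that not_less_Least unfolding n_def by blast
    ultimately have "computes (Mu g) [x] n"
      by (intro computes.mu) (auto simp: g_iff)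
    then show "computes (Comp c [Mu g]) [x] y"
      using c * by (intro computes.comp[where ys = "[n]"]) auto
  qed
  then show ?thesis by (rule that)
qed

lemma partial_computable_semidecidable:
  fixes S :: "nat \<Rightarrow> bool"
  assumes "semidecidable S"
  shows "partial_computable (\<lambda>x. if S x then Some 1 else None)"
proof -
  obtain f where "\<And>x y. computes f [x] y \<longleftrightarrow> S x \<and> y = 1"
    using assms by (rule semidecidable_imp_computes) blast
  then show ?thesis unfolding partial_computable_def by (intro exI[of _ f]) auto
qed

text \<open>The second argument is ignored, so s-m-n turns \<open>x\<close> into an index of a
  function that is either constantly 1 or nowhere defined.\<close>

lemma partial_computable2_semidecidable:
  fixes S :: "nat \<Rightarrow> bool"
  assumes "semidecidable S"
  shows "partial_computable2 (\<lambda>x y. if S x then Some 1 else None)"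
proof -
  obtain f where f: "\<And>x y. computes f [x] y \<longleftrightarrow> S x \<and> y = 1"
    using assms by (rule semidecidable_imp_computes) blast
  have "computes (Comp f [Proj 0]) [x, y] z \<longleftrightarrow> computes f [x] z" for x y z
  proof
    assume "computes (Comp f [Proj 0]) [x, y] z"
    then show "computes f [x] z"
      by (auto elim!: computes_CompE computes_ProjE simp: list_all2_Cons1)
  next
    assume "computes f [x] z"
    then show "computes (Comp f [Proj 0]) [x, y] z"
      using computes.proj[of 0 "[x, y]"] by (intro computes.comp[where ys = "[x]"]) auto
  qed
  then show ?thesis
    unfolding partial_computable2_def by (intro exI[of _ "Comp f [Proj 0]"]) (auto simp: f)
qed

lemma ce_iff_semidecidable: "ce A \<longleftrightarrow> semidecidable (\<lambda>x. x \<in> A)"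
proof
  assume "ce A"
  then obtain f where "\<And>x. x \<in> A \<longleftrightarrow> (\<exists>y. computes f [x] y)"
    unfolding ce_def partial_computable_def by (auto simp: dom_def)
  then show "semidecidable (\<lambda>x. x \<in> A)"
    by (simp only:) (intro semidecidable_intros semidecidable_compose2[OF semidecidable_computes] computable_intros)
next
  assume "semidecidable (\<lambda>x. x \<in> A)"
  from partial_computable_semidecidable[OF this] show "ce A"
    unfolding ce_def
    by (intro exI[of _ "\<lambda>x. if x \<in> A then Some 1 else None"]) (auto simp: dom_def)
qed

text \<open>For total functions determinism reduces the equivalence with \<open>computes\<close> to
  one direction; the Cantor pairing then trades two arguments for one.\<close>

lemma computable_rel_iff_decidable: "computable_rel R \<longleftrightarrow> decidable (\<lambda>z. R (fst z) (snd z))"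
proof -
  let ?F = "\<lambda>x y. if R x y then 1 else 0 :: nat"
  have "(\<forall>x y z. F x y = z \<longleftrightarrow> computes f [x, y] z) \<longleftrightarrow> (\<forall>x y. computes f [x, y] (F x y))"
    for f and F :: "nat \<Rightarrow> nat \<Rightarrow> nat"
    using computes_deterministic by blast
  then have "computable_rel R \<longleftrightarrow> recursive2 ?F"
    unfolding computable_rel_def partial_computable2_def recursive2_iff[of ?F] option.inject by (simp only:)
  also have "\<dots> \<longleftrightarrow> computable (\<lambda>n. ?F (fst (prod_decode n)) (snd (prod_decode n)))"
    (is "_ \<longleftrightarrow> computable ?G")
  proof
    assume "recursive2 ?F"
    then show "computable ?G"
      using computable_prod_decode unfolding computable_iff_recursive by (rule recursive_comp2)
  next
    assume "computable ?G"
    then have "recursive2 (\<lambda>x y. ?G (prod_encode (x, y)))"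
      by (intro recursive_comp[of ?G] recursive_comp2[OF recursive2_prod_encode] recursive_nth) auto
    then show "recursive2 ?F" by simp
  qed
  also have "\<dots> \<longleftrightarrow> decidable (\<lambda>z. R (fst z) (snd z))"
    unfolding decidable_def computable_map_def by (simp add: decode_prod)
  finally show ?thesis .
qed

lemma Sigma01_iff_ce: "Sigma01 A \<longleftrightarrow> ce A"
  unfolding Sigma01_def ce_iff_semidecidable semidecidable_def computable_rel_iff_decidable
  by blast

subsection \<open>Self-referential reductions\<close>

text \<open>Here \<open>h z\<close> may be thought of as a program that knows its own index. The property yields
  1-completeness of \<open>A\<close> without a separate padding lemma for \<open>\<phi>\<close>.\<close>

definition self_referential :: "nat set \<Rightarrow> bool" where
  "self_referential A \<longleftrightarrow> (\<forall>C. semidecidable C \<longrightarrow>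
    (\<exists>h :: nat \<Rightarrow> nat. computable_map h \<and> (\<forall>z. h z \<in> A \<longleftrightarrow> C (h z, z))))"

lemma self_referentialE:
  fixes C :: "nat \<Rightarrow> 'a::coded \<Rightarrow> bool"
  assumes A: "self_referential A" and C: "semidecidable (\<lambda>z. C (fst z) (snd z))"
  obtains h where "computable_map h" "\<And>z. h z \<in> A \<longleftrightarrow> C (h z) z"
proof -
  have "semidecidable (\<lambda>z :: nat \<times> nat. C (fst z) (decode (snd z)))"
    by (intro semidecidable_compose2[OF C] computable_intros)
  from A[unfolded self_referential_def, rule_format, OF this]
  obtain h :: "nat \<Rightarrow> nat" where h: "computable_map h" "\<And>n. h n \<in> A \<longleftrightarrow> C (h n) (decode n)"
    by auto
  show thesis
  proof (rule that)
    show "computable_map (\<lambda>z. h (code z))"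
      by (intro computable_map_compose[OF h(1)] computable_intros)
    show "h (code z) \<in> A \<longleftrightarrow> C (h (code z)) z" for z
      using h(2) by simp
  qed
qed

section \<open>The recursion theorem and its use for \<open>M_set\<close> and
  \<open>K_set\<close>\<close>

lemma semidecidable_numbering:
  assumes "acceptable_numbering \<phi>" "computable_map e" "computable_map x" "computable_map y"
  shows "semidecidable (\<lambda>z. \<phi> (e z) (x z) = Some (y z))"
proof -
  have "partial_computable2 \<phi>" using assms(1) unfolding acceptable_numbering_def by blast
  from semidecidable_compose[OF semidecidable_partial_computable2[OF this],
      of "\<lambda>z. (e z, x z, y z)"] show ?thesis
    using assms(2-4) by (simp add: computable_map_Pair)
qed

lemma semidecidable_halting:
  assumes "acceptable_numbering \<phi>" "computable_map e" "computable_map x"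
  shows "semidecidable (\<lambda>z. \<phi> (e z) (x z) \<noteq> None)"
  unfolding not_None_eq
  by (intro semidecidable_intros semidecidable_numbering[OF assms(1)] computable_intros
      computable_map_compose[OF assms(2)] computable_map_compose[OF assms(3)])

text \<open>Kleene's diagonal argument with a parameter: an index-producing function
  \<open>s\<close> is itself given an index \<open>v\<close>, and \<open>h z\<close> is
  \<open>s\<close> at the code of \<open>(v, z)\<close>.\<close>

lemma recursion_theorem:
  assumes \<phi>: "acceptable_numbering \<phi>" and C: "semidecidable C"
  obtains h :: "nat \<Rightarrow> nat" where "computable_map h"
    "\<And>z y. \<phi> (h z) y = (if C (h z, z) then Some 1 else None)"
proof -
  \<comment> \<open>The first component of \<open>w\<close> is run as a program on \<open>w\<close>
    itself. Its output \<open>u\<close> is meant to be the index of the program being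
    defined.\<close>
  define S where "S w \<longleftrightarrow> (\<exists>u. \<phi> (fst (prod_decode w)) w = Some u \<and> C (u, snd (prod_decode w)))" for w
  have "semidecidable S"
    unfolding S_def
    by (intro semidecidable_intros semidecidable_compose[OF C] semidecidable_numbering[OF \<phi>] computable_intros)
  from partial_computable2_semidecidable[OF this]
  obtain s where s: "computable s" "\<And>w y. \<phi> (s w) y = (if S w then Some 1 else None)"
    using \<phi> unfolding acceptable_numbering_def by blast
  have "(\<lambda>w. Some (s w)) \<in> range \<phi>"
    using s(1) \<phi> unfolding acceptable_numbering_def computable_def by blast
  \<comment> \<open>This closes the circle: at the code \<open>w\<close> of \<open>(v, z)\<close>
    the number \<open>u\<close> in \<open>S\<close> is \<open>s w\<close>, which is
    \<open>h z\<close>.\<close>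
  then obtain v where v: "\<phi> v = (\<lambda>w. Some (s w))" by auto
  show thesis
  proof (rule that)
    show "computable_map (\<lambda>z. s (prod_encode (v, z)))"
      using s(1) unfolding computable_map_nat[symmetric]
      by (rule computable_map_compose) (intro computable_intros)
    show "\<phi> (s (prod_encode (v, z))) y = (if C (s (prod_encode (v, z)), z) then Some 1 else None)" for z y
      by (simp add: s(2) S_def v)
  qed
qed

text \<open>The programs of the recursion theorem ignore their input, so their behaviour at 0, and
  for \<open>K_set \<phi>\<close> at their own index, depends on \<open>C\<close> alone.\<close>

lemma self_referential_M_set:
  assumes "acceptable_numbering \<phi>"
  shows "self_referential (M_set \<phi>)"
  unfolding self_referential_def
proof (intro allI impI)
  fix C assume C: "semidecidable (C :: nat \<times> nat \<Rightarrow> bool)"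
  obtain h where "computable_map h" "\<And>z y. \<phi> (h z) y = (if C (h z, z) then Some 1 else None)"
    using assms C by (rule recursion_theorem) blast
  then show "\<exists>h. computable_map h \<and> (\<forall>z. h z \<in> M_set \<phi> \<longleftrightarrow> C (h z, z))"
    by (auto simp: M_set_def intro!: exI[of _ h] split: if_splits)
qed

lemma self_referential_K_set:
  assumes "acceptable_numbering \<phi>"
  shows "self_referential (K_set \<phi>)"
  unfolding self_referential_def
proof (intro allI impI)
  fix C assume C: "semidecidable (C :: nat \<times> nat \<Rightarrow> bool)"
  obtain h where "computable_map h" "\<And>z y. \<phi> (h z) y = (if C (h z, z) then Some 1 else None)"
    using assms C by (rule recursion_theorem) blast
  then show "\<exists>h. computable_map h \<and> (\<forall>z. h z \<in> K_set \<phi> \<longleftrightarrow> C (h z, z))"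
    by (auto simp: K_set_def intro!: exI[of _ h] split: if_splits)
qed

lemma ce_M_set: "acceptable_numbering \<phi> \<Longrightarrow> ce (M_set \<phi>)"
  unfolding ce_iff_semidecidable M_set_def mem_Collect_eq
  by (intro semidecidable_numbering computable_intros)

lemma ce_K_set: "acceptable_numbering \<phi> \<Longrightarrow> ce (K_set \<phi>)"
  unfolding ce_iff_semidecidable K_set_def mem_Collect_eq
  by (intro semidecidable_halting computable_intros)

text \<open>\<open>h e\<close> enters \<open>A\<close> exactly if it enters the domain of \<open>\<phi> e\<close>.\<close>

lemma self_referential_creative:
  assumes \<phi>: "acceptable_numbering \<phi>" and A: "self_referential A" "ce A"
  shows "creative \<phi> A"
proof -
  have "semidecidable (\<lambda>z. \<phi> (snd z) (fst z) \<noteq> None)"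
    by (intro semidecidable_halting[OF \<phi>] computable_intros)
  with A(1) obtain h where h: "computable_map h" "\<And>e. h e \<in> A \<longleftrightarrow> \<phi> e (h e) \<noteq> None"
    by (rule self_referentialE) blast
  have "\<exists>y. Some (h e) = Some y \<and> y \<in> - A - dom (\<phi> e)" if "dom (\<phi> e) \<subseteq> - A" for e
    using that h(2)[of e] by (auto simp: dom_def)
  moreover have "partial_computable (\<lambda>e. Some (h e))"
    using h(1) by (simp add: computable_map_nat computable_def)
  ultimately show ?thesis
    using A(2) unfolding creative_def productive_def by blast
qed

subsection \<open>Elements outside a finite set\<close>

text \<open>If \<open>g z\<close> is not new then it does not belong to \<open>A\<close>, so neither do the other elements of \<open>E\<close>
  and \<open>B x\<close> fails; then \<open>h z\<close>, which would belong to \<open>A\<close> if it were not new, is new.\<close>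

lemma new_element:
  fixes B :: "nat \<Rightarrow> bool"
  assumes A: "self_referential A" and B: "semidecidable B"
  obtains f where "computable_map f"
    "\<And>x E. \<forall>e\<in>set E. e \<in> A \<longleftrightarrow> B x \<Longrightarrow> f (x, E) \<notin> set E \<and> (f (x, E) \<in> A \<longleftrightarrow> B x)"
proof -
  have "semidecidable (\<lambda>z. fst z \<notin> set (snd (snd z)) \<and> B (fst (snd z)))"
    by (intro semidecidable_intros semidecidable_compose[OF B]
        decidable_imp_semidecidable[OF decidable_not] computable_intros)
  with A obtain g :: "nat \<times> nat list \<Rightarrow> nat" where
    g: "computable_map g" "\<And>z. g z \<in> A \<longleftrightarrow> g z \<notin> set (snd z) \<and> B (fst z)"
    by (rule self_referentialE) blast
  have "semidecidable (\<lambda>z. fst z \<in> set (snd (snd z)) \<or> B (fst (snd z)))"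
    by (intro semidecidable_intros semidecidable_compose[OF B]
        decidable_imp_semidecidable[OF decidable_in_set] computable_intros)
  with A obtain h :: "nat \<times> nat list \<Rightarrow> nat" where
    h: "computable_map h" "\<And>z. h z \<in> A \<longleftrightarrow> h z \<in> set (snd z) \<or> B (fst z)"
    by (rule self_referentialE) blast
  show thesis
  proof (rule that)
    \<comment> \<open>Membership in a finite list is decidable, so the choice between
      \<open>g\<close> and \<open>h\<close> is computable although \<open>B\<close> is only
      semidecidable.\<close>
    show "computable_map (\<lambda>z. if g z \<in> set (snd z) then h z else g z)"
      by (intro computable_intros g h)
    fix x E assume E: "\<forall>e\<in>set E. e \<in> A \<longleftrightarrow> B x"
    show "(if g (x, E) \<in> set (snd (x, E)) then h (x, E) else g (x, E)) \<notin> set E \<and>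
      ((if g (x, E) \<in> set (snd (x, E)) then h (x, E) else g (x, E)) \<in> A \<longleftrightarrow> B x)"
      using g(2)[of "(x, E)"] h(2)[of "(x, E)"] E by auto
  qed
qed

text \<open>Iterating the previous lemma produces arbitrarily many distinct elements that belong to \<open>A\<close>
  exactly if \<open>B x\<close>, so one of them lies outside a given finite set, whose elements may be arbitrary.\<close>

lemma fresh_element:
  fixes B :: "nat \<Rightarrow> bool"
  assumes "self_referential A" "semidecidable B"
  obtains f where "computable_map f"
    "\<And>x D. f (x, D) \<notin> set D" "\<And>x D. f (x, D) \<in> A \<longleftrightarrow> B x"
proof -
  obtain f where f: "computable_map f"
    "\<And>x E. \<forall>e\<in>set E. e \<in> A \<longleftrightarrow> B x \<Longrightarrow> f (x, E) \<notin> set E \<and> (f (x, E) \<in> A \<longleftrightarrow> B x)"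
    using assms by (rule new_element) blast
  \<comment> \<open>\<open>D\<close> is not passed to \<open>f\<close>, as its elements may disagree
    about membership in \<open>A\<close>; those of \<open>E x j\<close> all agree with
    \<open>B x\<close>.\<close>
  define E where "E x j = rec_nat [] (\<lambda>_ E. f (x, E) # E) j" for x j
  have E_simps: "E x 0 = []" "E x (Suc j) = f (x, E x j) # E x j" for x j
    by (simp_all add: E_def)
  have E: "(\<forall>e\<in>set (E x j). e \<in> A \<longleftrightarrow> B x) \<and> distinct (E x j) \<and> length (E x j) = j" for x j
  proof (induction j)
    case (Suc j)
    then show ?case using f(2)[of "E x j" x] by (simp add: E_simps)
  qed (simp add: E_simps)
  have E_comp: "computable_map (\<lambda>z. E (a z) (b z))" if "computable_map a" "computable_map b"
    for a b :: "'a::coded \<Rightarrow> nat"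
    unfolding E_def
    by (intro computable_map_rec_nat computable_intros computable_map_compose[OF f(1)]
        computable_map_compose[OF that(1)] that)
  \<comment> \<open>Pigeonhole: otherwise all lists \<open>E x j\<close> would stay inside
    \<open>set D\<close>, but \<open>E x j\<close> has \<open>j\<close> distinct entries.\<close>
  have ex: "\<exists>j. f (x, E x j) \<notin> set D" for x D
  proof (rule ccontr)
    assume "\<nexists>j. f (x, E x j) \<notin> set D"
    then have "set (E x j) \<subseteq> set D" for j
      by (induction j) (auto simp: E_simps)
    then have "card (set (E x (Suc (card (set D))))) \<le> card (set D)"
      by (intro card_mono) auto
    with E[of x "Suc (card (set D))"] show False by (simp add: distinct_card)
  qed
  define j where "j z = (LEAST j. f (fst z, E (fst z) j) \<notin> set (snd z))" for z
  have j_comp: "computable_map j"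
    unfolding j_def
    by (intro computable_map_Least ex computable_intros computable_map_compose[OF f(1)] E_comp)
  show thesis
  proof (rule that)
    show "computable_map (\<lambda>z. f (fst z, E (fst z) (j z)))"
      by (intro computable_map_compose[OF f(1)] computable_intros E_comp j_comp)
    show "f (fst (x, D), E (fst (x, D)) (j (x, D))) \<notin> set D" for x D
      using LeastI_ex[OF ex[of x D]] by (simp add: j_def)
    show "f (fst (x, D), E (fst (x, D)) (j (x, D))) \<in> A \<longleftrightarrow> B x" for x D
      using E f(2) by simp
  qed
qed

text \<open>Values are chosen one after another, each outside the list \<open>L k\<close> of the
  values at smaller arguments, which makes the reduction injective.\<close>

lemma self_referential_one_reducible:
  assumes A: "self_referential A" and B: "ce B"
  shows "one_reducible B A"
proof -
  obtain f where f: "computable_map f" "\<And>x D. f (x, D) \<notin> set D" "\<And>x D. f (x, D) \<in> A \<longleftrightarrow> x \<in> B"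
    using A B[unfolded ce_iff_semidecidable] by (rule fresh_element) blast
  define L where "L k = rec_nat [] (\<lambda>k L. f (k, L) # L) k" for k
  have L_Suc: "L (Suc k) = f (k, L k) # L k" for k by (simp add: L_def)
  have mem: "i < k \<Longrightarrow> f (i, L i) \<in> set (L k)" for i k
    by (induction k) (auto simp: L_Suc less_Suc_eq)
  have "inj (\<lambda>k. f (k, L k))"
  proof (rule linorder_injI)
    fix i k :: nat assume "i < k"
    then show "f (i, L i) \<noteq> f (k, L k)" using mem f(2) by metis
  qed
  moreover have "computable_map (\<lambda>k. f (k, L k))"
    unfolding L_def
    by (intro computable_map_compose[OF f(1)] computable_map_rec_nat computable_intros)
  ultimately show ?thesis
    unfolding one_reducible_def computable_map_nat using f(3) by blast
qed

subsection \<open>Back and forth\<close>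

text \<open>As in Myhill's theorem, finite injective correspondences respecting membership are
  extended alternately on both sides, with fresh partners supplied by \<open>f\<close> and
  \<open>g\<close>.\<close>

lemma self_referential_isomorphic:
  assumes A: "self_referential A" "ce A" and B: "self_referential B" "ce B"
  shows "computably_isomorphic A B"
proof -
  obtain f where f: "computable_map f" "\<And>x D. f (x, D) \<notin> set D" "\<And>x D. f (x, D) \<in> B \<longleftrightarrow> x \<in> A"
    using B(1) A(2)[unfolded ce_iff_semidecidable] by (rule fresh_element) blast
  obtain g where g: "computable_map g" "\<And>x D. g (x, D) \<notin> set D" "\<And>x D. g (x, D) \<in> A \<longleftrightarrow> x \<in> B"
    using A(1) B(2)[unfolded ce_iff_semidecidable] by (rule fresh_element) blast
  define left where "left D = rev (map fst D)" for D :: "(nat \<times> nat) list"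
  define right where "right D = rev (map snd D)" for D :: "(nat \<times> nat) list"
  have set_left: "set (left D) = fst ` set D" and set_right: "set (right D) = snd ` set D" for D
    by (simp_all add: left_def right_def)
  define extend_left where "extend_left k D = (if k \<in> set (left D) then D else (k, f (k, right D)) # D)" for k D
  define extend_right where "extend_right k D = (if k \<in> set (right D) then D else (g (k, left D), k) # D)" for k D
  \<comment> \<open>Passing to stage \<open>Suc k\<close> puts \<open>k\<close> on both sides, so
    every number gets a partner in either direction.\<close>
  define stage where "stage k = rec_nat [] (\<lambda>k D. extend_right k (extend_left k D)) k" for k
  have stage_simps: "stage 0 = []" "stage (Suc k) = extend_right k (extend_left k (stage k))" for k
    by (simp_all add: stage_def)

  \<comment> \<open>Injectivity of \<open>fst\<close> makes \<open>D\<close> the graph of a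
    function, and injectivity of \<open>snd\<close> makes that function injective.\<close>
  define good where "good D \<longleftrightarrow> inj_on fst (set D) \<and> inj_on snd (set D) \<and>
    (\<forall>(a, b)\<in>set D. a \<in> A \<longleftrightarrow> b \<in> B)" for D :: "(nat \<times> nat) list"
  have good_left: "good (extend_left k D)" if "good D" for k D
    using that f(2,3)[of k "right D"]
    by (force simp: good_def extend_left_def set_left set_right)
  have good_right: "good (extend_right k D)" if "good D" for k D
    using that g(2,3)[of k "left D"]
    by (force simp: good_def extend_right_def set_left set_right)
  have good: "good (stage k)" for k
    by (induction k) (simp add: good_def stage_simps, simp add: stage_simps good_left good_right)

  have mono: "set (stage i) \<subseteq> set (stage k)" if "i \<le> k" for i k
    using that by (induction k rule: dec_induct) (auto simp: stage_simps extend_left_def extend_right_def)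
  have common: "\<exists>k. p \<in> set (stage k) \<and> q \<in> set (stage k)"
    if "p \<in> set (stage i)" "q \<in> set (stage j)" for p q i j
    using that mono[of i "max i j"] mono[of j "max i j"] by auto
  have total: "\<exists>y. (k, y) \<in> set (stage (Suc k))" for k
    by (force simp: stage_simps extend_left_def extend_right_def set_left)
  have onto: "\<exists>x. (x, k) \<in> set (stage (Suc k))" for k
    by (force simp: stage_simps extend_right_def set_right)

  \<comment> \<open>The partner is unique because the stages are \<open>good\<close>; writing it as
    a least number exhibits it as the result of a computable search.\<close>
  define \<pi> where "\<pi> k = (LEAST y. (k, y) \<in> set (stage (Suc k)))" for k
  have \<pi>: "(k, \<pi> k) \<in> set (stage (Suc k))" for k
    unfolding \<pi>_def by (rule LeastI_ex) (rule total)
  \<comment> \<open>The pairs \<open>(x, y)\<close> and \<open>(x, \<pi> x)\<close> lie in a common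
    stage, which is the graph of a function.\<close>
  have \<pi>_eq: "\<pi> x = y" if "(x, y) \<in> set (stage k)" for x y k
    using common[OF \<pi>[of x] that] good unfolding good_def inj_on_def by fastforce
  have "inj \<pi>"
  proof (rule injI)
    fix x y assume "\<pi> x = \<pi> y"
    then show "x = y"
      using common[OF \<pi>[of x] \<pi>[of y]] good unfolding good_def inj_on_def by fastforce
  qed
  moreover have "surj \<pi>" using onto \<pi>_eq by (metis surjI)
  moreover have mem: "\<pi> x \<in> B \<longleftrightarrow> x \<in> A" for x
    using \<pi>[of x] good[of "Suc x"] unfolding good_def by auto
  moreover have "\<pi> ` A = B"
    using mem \<open>surj \<pi>\<close> by (metis image_eqI image_subsetI subsetI subset_antisym surj_def)
  moreover have "computable_map \<pi>"
  proof -
    \<comment> \<open>The recursion rule takes the step on triples of counter, current list and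
      parameter. The parameter is the pair of argument and candidate value, which the step
      ignores.\<close>
    have left: "computable_map (\<lambda>z :: nat \<times> (nat \<times> nat) list \<times> nat \<times> nat. extend_left (fst z) (fst (snd z)))"
      unfolding extend_left_def left_def right_def
      by (intro computable_intros computable_map_compose[OF f(1)] computable_map_fst computable_map_snd)
    have right: "computable_map (\<lambda>z. extend_right (fst z) (snd z))"
      unfolding extend_right_def left_def right_def
      by (intro computable_intros computable_map_compose[OF g(1)] computable_map_fst computable_map_snd)
    have step: "computable_map (\<lambda>z :: nat \<times> (nat \<times> nat) list \<times> nat \<times> nat.
        extend_right (fst z) (extend_left (fst z) (fst (snd z))))"
      using computable_map_compose[OF right computable_map_Pair[OF computable_map_fst left]] by simp
    show ?thesis
      unfolding \<pi>_def stage_def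
      by (intro computable_map_Least total[unfolded stage_def] computable_intros computable_map_rec_nat step)
  qed
  ultimately show ?thesis
    unfolding computably_isomorphic_def computable_map_nat bij_def by blast
qed

theorem proposition7p1:
  fixes \<phi> :: "nat \<Rightarrow> nat \<rightharpoonup> nat"
  assumes "acceptable_numbering \<phi>"
  shows "Sigma01_complete (M_set \<phi>) \<and> one_complete (M_set \<phi>) \<and> creative \<phi> (M_set \<phi>) \<and>
         computably_isomorphic (M_set \<phi>) (K_set \<phi>)"
proof -
  note M = self_referential_M_set[OF assms] ce_M_set[OF assms]
  note K = self_referential_K_set[OF assms] ce_K_set[OF assms]
  have one: "one_complete (M_set \<phi>)"
    unfolding one_complete_def using M self_referential_one_reducible by blast
  \<comment> \<open>\<open>Sigma01\<close> and \<open>ce\<close> describe the same sets, and a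
    1-reduction is in particular a many-one reduction.\<close>
  then have "Sigma01_complete (M_set \<phi>)"
    unfolding Sigma01_complete_def one_complete_def Sigma01_iff_ce m_reducible_def one_reducible_def
    by blast
  with one show ?thesis
    using self_referential_creative[OF assms M] self_referential_isomorphic[OF M K] by blast
qed

end
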